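(* Let $n\geq 2$ be an integer, let $C\subset\mathbb{R}^n$ be a self-avoiding complete curve, and let $w\in\mathbb{R}^n$, $w\neq 0$, be such that $C=w+C$. Then there exists a bounded subset $B\subset C$ such that $C$ is the disjoint union of the subsets $kw+B$ for $k\in\mathbb{Z}$.
   Context: A self-avoiding complete curve in $\mathbb{R}^n$ is a closed subset $C\subset\mathbb{R}^n$ for which there exists a bicontinuous map (a homeomorphism) from $\mathbb{R}$ onto $C$. *)

theory Defs
  imports "HOL-Analysis.Analysis"
begin

definition self_avoiding_complete_curve :: "(real ^ 'n) set \<Rightarrow> bool" where
  "self_avoiding_complete_curve C \<longleftrightarrow>
     closed C \<and> (\<exists>f g. homeomorphism (UNIV :: real set) C f g)"

end

(* A parametrization f of C turns the translations by k w, k an integer, into homeomorphisms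
   S k of the real line.  For k nonzero they have no fixed point, so they are strictly increasing (a decreasing
   one would have a fixed point by the intermediate value theorem).  Hence, choosing the direction
   of f suitably, the orbit a k = S k 0 is strictly increasing; since the points k w + f 0 leave
   every compact set, it is unbounded in both directions.  The intervals [a k, a (k + 1)) therefore
   partition the line, and S k maps [a 0, a 1) onto [a k, a (k + 1)). *)

theory Submission
  imports Defs
begin

text \<open>A continuous injection of the line is monotone in one direction, so a single descent
  makes it decreasing everywhere; \<open>T x - x\<close> then changes sign between \<open>0\<close>
  and \<open>T 0\<close>.\<close>

lemma strict_mono_if_no_fixed_point:
  fixes T :: "real \<Rightarrow> real"
  assumes cont: "continuous_on UNIV T" and "inj T" and nofix: "\<And>x. T x \<noteq> x"
  shows "strict_mono T"
proof (rule ccontr)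
  assume "\<not> strict_mono T"
  then obtain p q where "p < q" "T q \<le> T p"
    by (auto simp: strict_mono_def not_less)
  with \<open>inj T\<close> have pq: "p < q" "T q < T p"
    by (auto simp: inj_def less_le)
  have decr: "T y < T x" if "x < y" for x y
  proof -
    have mono: "(T u < T v \<and> T v < T z) \<or> (T z < T v \<and> T v < T u)" if "u < v" "v < z" for u v z
    proof -
      have "continuous_on {u..z} T" "inj_on T {u..z}"
        using cont \<open>inj T\<close> by (auto intro: continuous_on_subset inj_on_subset)
      from continuous_inj_imp_mono[OF that this] show ?thesis by auto
    qed
    \<comment> \<open>The points \<open>l\<close> and \<open>r\<close> lie outside both pairs, so
      triples carry the descent from \<open>p\<close>, \<open>q\<close> to \<open>l\<close>,
      \<open>r\<close>, and from there to \<open>x\<close>, \<open>y\<close>.\<close>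
    define l where "l = min x p - 1"
    define r where "r = max y q + 1"
    have ord: "l < x" "l < p" "y < r" "q < r"
      by (auto simp: l_def r_def)
    have "T r < T l"
      using mono[of l p q] mono[of l q r] ord pq by auto
    then show ?thesis
      using mono[of l x y] mono[of l y r] ord that by auto
  qed
  let ?h = "\<lambda>x. T x - x"
  have "\<exists>x. ?h x = 0"
  proof -
    have ch: "continuous_on A ?h" for A
      by (intro continuous_intros continuous_on_subset[OF cont]) auto
    consider "T 0 > 0" | "T 0 < 0"
      using nofix[of 0] by linarith
    then show ?thesis
    proof cases
      \<comment> \<open>As \<open>T\<close> decreases, \<open>T (T 0) < T 0\<close>:
        \<open>?h\<close> is positive at \<open>0\<close> and negative at \<open>T 0\<close>. The
        other case is symmetric.\<close>
      case 1
      then show ?thesis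
        using IVT2'[of ?h "T 0" 0 0] decr[of 0 "T 0"] ch by auto
    next
      case 2
      then show ?thesis
        using IVT2'[of ?h 0 0 "T 0"] decr[of "T 0" 0] ch by auto
    qed
  qed
  then show False
    using nofix by auto
qed

text \<open>Without such a \<open>k\<close>, the bound \<open>a k \<le> t\<close> would pass from
  every \<open>k\<close> to \<open>k + 1\<close>, hence from \<open>m\<close> up to
  \<open>n\<close>, against \<open>hi\<close>.\<close>

lemma strict_mono_int_bracket:
  fixes a :: "int \<Rightarrow> real"
  assumes "strict_mono a" and lo: "a m \<le> t" and hi: "t < a n"
  shows "\<exists>k. a k \<le> t \<and> t < a (k + 1)"
proof (rule ccontr)
  assume *: "\<nexists>k. a k \<le> t \<and> t < a (k + 1)"
  have "m \<le> n"
    using assms by (meson le_less_trans strict_mono_less less_imp_le)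
  then have "a n \<le> t"
    by (induction rule: int_ge_induct) (use lo * in \<open>force+\<close>)
  with hi show False by simp
qed

text \<open>One inclusion of \<open>C = w + C\<close> gives the steps up in \<open>k\<close>, the
  other the steps down.\<close>

lemma int_translate_mem:
  fixes w :: "'a::real_vector"
  assumes "C = (\<lambda>x. w + x) ` C" and "x \<in> C"
  shows "of_int k *\<^sub>R w + x \<in> C"
proof (induction k rule: int_induct[where k = 0])
  case base
  then show ?case using \<open>x \<in> C\<close> by simp
next
  case (step1 i)
  then have "w + (of_int i *\<^sub>R w + x) \<in> C"
    using assms(1) by blast
  then show ?case by (simp add: algebra_simps)
next
  case (step2 i)
  then obtain y where "y \<in> C" "of_int i *\<^sub>R w + x = w + y"
    using assms(1) by blast
  moreover from this have "y = of_int (i - 1) *\<^sub>R w + x"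
    by (simp add: algebra_simps)
  ultimately show ?case by simp
qed

text \<open>The case in which translation by \<open>w\<close> moves the parameter \<open>0\<close>
  to the right; reversing the parametrization reduces the other case to this one.\<close>

lemma periodic_curve_partition_increasing:
  fixes C :: "'a::real_normed_vector set"
  assumes hom: "homeomorphism (UNIV :: real set) C f g"
    and w: "w \<noteq> 0" and inv: "C = (\<lambda>x. w + x) ` C"
    and up: "0 < g (w + f 0)"
  shows "\<exists>B. B \<subseteq> C \<and> bounded B \<and>
           C = (\<Union>k::int. (\<lambda>x. of_int k *\<^sub>R w + x) ` B) \<and>
           disjoint_family (\<lambda>k::int. (\<lambda>x. of_int k *\<^sub>R w + x) ` B)"
proof -
  have gf [simp]: "g (f t) = t" and fC [simp]: "f t \<in> C" for t
    using hom by (auto simp: homeomorphism_def)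
  have fg [simp]: "f (g x) = x" if "x \<in> C" for x
    using hom that by (auto simp: homeomorphism_def)
  have cf: "continuous_on A f" for A
    using hom by (auto simp: homeomorphism_def intro: continuous_on_subset)
  have cg: "continuous_on C g"
    using hom by (auto simp: homeomorphism_def)
  have trC [simp]: "of_int k *\<^sub>R w + x \<in> C" if "x \<in> C" for k x
    using int_translate_mem[OF inv that] .
  \<comment> \<open>Translation by \<open>k w\<close> read in the parameter; \<open>SS\<close> and
    \<open>S0\<close> make this an action of the integers, so \<open>S (- k)\<close> inverts
    \<open>S k\<close>.\<close>
  define S where "S k t = g (of_int k *\<^sub>R w + f t)" for k :: int and t
  define a where "a k = S k 0" for k
  have fS: "f (S k t) = of_int k *\<^sub>R w + f t" for k t
    by (simp add: S_def)
  have SS: "S j (S k t) = S (j + k) t" for j k t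
    unfolding S_def[of j] fS by (simp add: S_def algebra_simps)
  have S0: "S 0 t = t" for t
    by (simp add: S_def)
  have S_mono: "strict_mono (S k)" for k
  proof (cases "k = 0")
    case True
    then show ?thesis by (simp add: S0 strict_mono_def)
  next
    case False
    show ?thesis
    proof (rule strict_mono_if_no_fixed_point)
      show "continuous_on UNIV (S k)"
        unfolding S_def
        by (rule continuous_on_compose2[OF cg]) (auto intro!: continuous_intros cf)
      show "inj (S k)"
        by (rule inj_on_inverseI[where g = "S (- k)"]) (simp add: SS S0)
      show "S k t \<noteq> t" for t
      proof
        assume "S k t = t"
        with fS[of k t] have "of_int k *\<^sub>R w = 0" by simp
        with w False show False by simp
      qed
    qed
  qed
  have S_le: "S k x \<le> S k y \<longleftrightarrow> x \<le> y" and S_less: "S k x < S k y \<longleftrightarrow> x < y" for k x y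
    using S_mono[of k] by (auto simp: strict_mono_less_eq strict_mono_less)
  have Sa: "S j (a k) = a (j + k)" for j k
    by (simp add: a_def SS)
  have a0: "a 0 = 0"
    by (simp add: a_def S0)
  have a1: "0 < a 1"
    using up by (simp add: a_def S_def)
  have a_step: "a k < a (k + 1)" for k
    using S_less[of k "a 0" "a 1"] a0 a1 unfolding Sa by simp
  have a_mono: "strict_mono a"
  proof (rule strict_monoI)
    fix x y :: int
    assume "x < y"
    then have "x + 1 \<le> y" by simp
    then show "a x < a y"
      by (induction rule: int_ge_induct) (use a_step order.strict_trans in blast)+
  qed
  have bdd: "bounded (f ` {s..t})" for s t
    by (intro compact_imp_bounded compact_continuous_image cf compact_Icc)
  have escape: "\<exists>N > 0. \<forall>k. N \<le> \<bar>k\<bar> \<longrightarrow> a k \<notin> {s..t}" for s t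
  proof -
    obtain M where M: "\<And>u. u \<in> {s..t} \<Longrightarrow> norm (f u) \<le> M"
      using bdd[of s t] unfolding bounded_iff by blast
    \<comment> \<open>If \<open>a k\<close> is in the interval, then
      \<open>\<bar>k\<bar> * norm w \<le> M + norm (f 0)\<close>; the \<open>+ 1\<close> excludes
      this, and the \<open>max\<close> keeps \<open>N\<close> positive.\<close>
    define N where "N = max 1 (\<lfloor>(M + norm (f 0)) / norm w\<rfloor> + 1)"
    have "a k \<notin> {s..t}" if "N \<le> \<bar>k\<bar>" for k
    proof
      assume "a k \<in> {s..t}"
      then have "norm (of_int k *\<^sub>R w + f 0) \<le> M"
        using M[of "a k"] by (simp add: a_def fS)
      then have "norm (of_int k *\<^sub>R w) \<le> M + norm (f 0)"
        using norm_triangle_ineq4[of "of_int k *\<^sub>R w + f 0" "f 0"] by simp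
      then have "of_int \<bar>k\<bar> \<le> (M + norm (f 0)) / norm w"
        using w by (simp add: field_simps)
      then have "\<bar>k\<bar> \<le> \<lfloor>(M + norm (f 0)) / norm w\<rfloor>"
        by (simp add: le_floor_iff)
      with that show False by (simp add: N_def)
    qed
    moreover have "N > 0" by (simp add: N_def)
    ultimately show ?thesis by blast
  qed
  have cover: "\<exists>k. a k \<le> t \<and> t < a (k + 1)" for t
  proof -
    \<comment> \<open>The interval contains both \<open>0\<close> and \<open>t\<close>, so an orbit
      point outside it lies on the same side of \<open>t\<close> as of \<open>0\<close>.\<close>
    obtain N where N: "N > 0" "\<And>k. N \<le> \<bar>k\<bar> \<Longrightarrow> a k \<notin> {min 0 t..max 0 t}"
      using escape by blast
    have "a (- N) < 0" "0 < a N"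
      using strict_monoD[OF a_mono, of "- N" 0] strict_monoD[OF a_mono, of 0 N] N(1) a0 by auto
    then have "a (- N) \<le> t" "t < a N"
      using N(2)[of "- N"] N(2)[of N] N(1) by (auto simp: min_def max_def split: if_splits)
    then show ?thesis
      using strict_mono_int_bracket[OF a_mono] by blast
  qed
  define B where "B = f ` {0..<a 1}"
  have image: "(\<lambda>x. of_int k *\<^sub>R w + x) ` B = f ` {a k..<a (k + 1)}" for k
  proof -
    have "S k ` {0..<a 1} = {a k..<a (k + 1)}"
    proof (intro equalityI subsetI)
      fix t assume "t \<in> S k ` {0..<a 1}"
      then show "t \<in> {a k..<a (k + 1)}"
        using S_le[of k 0] S_less[of k _ "a 1"] by (auto simp: Sa a_def[of k])
    next
      fix t assume t: "t \<in> {a k..<a (k + 1)}"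
      have "t = S k (S (- k) t)" by (simp add: SS S0)
      moreover have "S (- k) t \<in> {0..<a 1}"
        using t S_le[of "- k" "a k" t] S_less[of "- k" t "a (k + 1)"] by (simp add: Sa a0)
      ultimately show "t \<in> S k ` {0..<a 1}" by blast
    qed
    moreover have "(\<lambda>x. of_int k *\<^sub>R w + x) ` B = f ` S k ` {0..<a 1}"
      by (simp add: B_def image_image fS)
    ultimately show ?thesis by simp
  qed
  have "B \<subseteq> C"
    by (auto simp: B_def)
  moreover have "bounded B"
    by (rule bounded_subset[OF bdd[of 0 "a 1"]]) (auto simp: B_def)
  moreover have "C = (\<Union>k::int. (\<lambda>x. of_int k *\<^sub>R w + x) ` B)"
  proof (intro equalityI subsetI)
    fix x assume "x \<in> C"
    moreover obtain k where "a k \<le> g x" "g x < a (k + 1)"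
      using cover by blast
    ultimately have "x \<in> f ` {a k..<a (k + 1)}"
      by (intro image_eqI[of _ _ "g x"]) auto
    then show "x \<in> (\<Union>k::int. (\<lambda>x. of_int k *\<^sub>R w + x) ` B)"
      unfolding image by blast
  qed (auto simp: B_def)
  moreover have "disjoint_family (\<lambda>k::int. (\<lambda>x. of_int k *\<^sub>R w + x) ` B)"
  proof -
    \<comment> \<open>Injectivity of \<open>f\<close> reduces disjointness of the translates to that
      of the half-open intervals.\<close>
    have "inj f"
      by (rule inj_on_inverseI[where g = g]) simp
    then show ?thesis
      unfolding image disjoint_family_on_def
      by (auto simp: image_Int[symmetric] strict_mono_less[OF a_mono])
  qed
  ultimately show ?thesis by blast
qed

theorem mainTheorem1:
  fixes C :: "(real ^ 'n) set" and w :: "real ^ 'n"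
  assumes "CARD('n) \<ge> 2"
    and "self_avoiding_complete_curve C"
    and "w \<noteq> 0"
    and "C = (\<lambda>x. w + x) ` C"
  shows "\<exists>B. B \<subseteq> C \<and> bounded B \<and>
           C = (\<Union>k::int. (\<lambda>x. of_int k *\<^sub>R w + x) ` B) \<and>
           disjoint_family (\<lambda>k::int. (\<lambda>x. of_int k *\<^sub>R w + x) ` B)"
proof -
  obtain f g where hom: "homeomorphism (UNIV :: real set) C f g"
    using assms(2) by (auto simp: self_avoiding_complete_curve_def)
  have "w + f 0 \<in> C"
    using hom assms(4) by (auto simp: homeomorphism_def)
  then have "f (g (w + f 0)) = w + f 0"
    using hom by (auto simp: homeomorphism_def)
  then have "g (w + f 0) \<noteq> 0"
    using \<open>w \<noteq> 0\<close> by auto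
  then consider "0 < g (w + f 0)" | "0 < - g (w + f 0)"
    by linarith
  then show ?thesis
  proof cases
    case 1
    then show ?thesis
      by (rule periodic_curve_partition_increasing[OF hom assms(3,4)])
  next
    case 2
    \<comment> \<open>Precomposing with \<open>uminus\<close> keeps the base point
      \<open>f 0\<close> and flips the sign of \<open>g (w + f 0)\<close>.\<close>
    have "homeomorphism (UNIV :: real set) UNIV uminus uminus"
      by (auto simp: homeomorphism_def intro!: continuous_intros)
    from homeomorphism_compose[OF this hom]
    have "homeomorphism UNIV C (f \<circ> uminus) (uminus \<circ> g)" .
    from periodic_curve_partition_increasing[OF this assms(3,4)] 2 show ?thesis
      by simp
  qed
qed

end
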